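(* For every $\varepsilon>0$ there exists a constant $N(\varepsilon)$ such that the following holds. If $G$ is a graph with $m$ edges and $\lambda(G)>\sqrt{m}$, then there exists a subgraph $G'$ of $G$ with $\lambda(G') > (1-\varepsilon)\sqrt{m} - N(\varepsilon)$ such that (a) $G'$ is bipartite, or (b) $G'$ has maximum degree at most $\varepsilon m$.
   Context: All graphs are finite, simple and undirected; $\lambda(H)$ denotes the largest eigenvalue of the adjacency matrix of a graph $H$. *)

theory Defs
  imports Complex_Main "Jordan_Normal_Form.Char_Poly"
begin

text \<open>A graph is given by its vertex set and its set of edges, an edge being a two-element set of
  vertices.  The null graph is excluded, since it has no eigenvalues and no maximum degree.\<close>

definition simple_graph :: "'a set \<Rightarrow> 'a set set \<Rightarrow> bool" where
  "simple_graph V E \<longleftrightarrow> finite V \<and> V \<noteq> {} \<and> (\<forall>e\<in>E. e \<subseteq> V \<and> card e = 2)"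

definition is_subgraph :: "'a set \<Rightarrow> 'a set set \<Rightarrow> 'a set \<Rightarrow> 'a set set \<Rightarrow> bool" where
  "is_subgraph V' E' V E \<longleftrightarrow> simple_graph V' E' \<and> V' \<subseteq> V \<and> E' \<subseteq> E"

definition adj_matrix :: "'a list \<Rightarrow> 'a set set \<Rightarrow> real mat" where
  "adj_matrix vs E =
     mat (length vs) (length vs) (\<lambda>(i, j). if {vs ! i, vs ! j} \<in> E then 1 else 0)"

text \<open>The vertices are listed in an arbitrary order to obtain a matrix; the lemma
  \<open>eigenvalue_adj_matrix_order\<close> below shows that the order does not affect the eigenvalues.
  The adjacency matrix is symmetric, so its eigenvalues are all real.\<close>

definition largest_eigenvalue :: "'a set \<Rightarrow> 'a set set \<Rightarrow> real" where
  "largest_eigenvalue V E =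
     Max {k. eigenvalue (adj_matrix (SOME vs. distinct vs \<and> set vs = V) E) k}"

definition bipartite :: "'a set \<Rightarrow> 'a set set \<Rightarrow> bool" where
  "bipartite V E \<longleftrightarrow>
     (\<exists>X Y. X \<union> Y = V \<and> X \<inter> Y = {} \<and> (\<forall>e\<in>E. \<exists>x\<in>X. \<exists>y\<in>Y. e = {x, y}))"

definition vertex_degree :: "'a set set \<Rightarrow> 'a \<Rightarrow> nat" where
  "vertex_degree E v = card {e \<in> E. v \<in> e}"

definition max_degree :: "'a set \<Rightarrow> 'a set set \<Rightarrow> nat" where
  "max_degree V E = Max (vertex_degree E ` V)"

lemma eigenvalue_adj_matrix_iff:
  assumes "distinct vs"
  shows "eigenvalue (adj_matrix vs E) k \<longleftrightarrow>
    (\<exists>x. (\<exists>v\<in>set vs. x v \<noteq> 0) \<and>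
         (\<forall>u\<in>set vs. (\<Sum>v\<in>set vs. (if {u, v} \<in> E then 1 else 0) * x v) = k * x u))"
    (is "?L \<longleftrightarrow> (\<exists>x. ?P x)")
proof -
  let ?n = "length vs" and ?A = "adj_matrix vs E"
  have bij: "bij_betw ((!) vs) {0..<?n} (set vs)"
    using bij_betw_nth[OF assms, of "{0..<?n}" "set vs"] by (simp add: atLeast0LessThan)
  have dim: "dim_row ?A = ?n" "dim_col ?A = ?n"
    by (simp_all add: adj_matrix_def)
  have row: "(?A *\<^sub>v vec ?n (\<lambda>i. x (vs ! i))) $ i =
      (\<Sum>v\<in>set vs. (if {vs ! i, v} \<in> E then 1 else 0) * x v)" if "i < ?n" for x i
    unfolding sum.reindex_bij_betw[OF bij, symmetric]
    using that by (auto simp: adj_matrix_def scalar_prod_def intro!: sum.cong)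
  have iff: "eigenvector ?A (vec ?n (\<lambda>i. x (vs ! i))) k \<longleftrightarrow> ?P x" for x
  proof -
    have "vec ?n (\<lambda>i. x (vs ! i)) = 0\<^sub>v ?n \<longleftrightarrow> (\<forall>v\<in>set vs. x v = 0)"
      by (auto simp: vec_eq_iff all_set_conv_all_nth)
    moreover have "?A *\<^sub>v vec ?n (\<lambda>i. x (vs ! i)) = k \<cdot>\<^sub>v vec ?n (\<lambda>i. x (vs ! i)) \<longleftrightarrow>
        (\<forall>u\<in>set vs. (\<Sum>v\<in>set vs. (if {u, v} \<in> E then 1 else 0) * x v) = k * x u)"
      unfolding all_set_conv_all_nth using row[of _ x] dim
      by (subst vec_eq_iff) (simp del: index_mult_mat_vec)
    ultimately show ?thesis
      unfolding eigenvector_def dim by auto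
  qed
  show ?thesis
  proof
    assume ?L
    then obtain w where w: "eigenvector ?A w k" by (auto simp: eigenvalue_def)
    then have dw: "dim_vec w = ?n" by (auto simp: eigenvector_def dim)
    define x where "x v = w $ (inv_into {0..<?n} ((!) vs) v)" for v
    have "w = vec ?n (\<lambda>i. x (vs ! i))"
      using dw bij by (auto simp: vec_eq_iff x_def bij_betw_def inv_into_f_f)
    with w have "eigenvector ?A (vec ?n (\<lambda>i. x (vs ! i))) k" by simp
    then have "?P x" unfolding iff .
    then show "\<exists>x. ?P x" by (rule exI[of _ x])
  next
    assume "\<exists>x. ?P x"
    then obtain x where "?P x" ..
    then have "eigenvector ?A (vec ?n (\<lambda>i. x (vs ! i))) k" unfolding iff .
    then show ?L unfolding eigenvalue_def ..
  qed
qed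

lemma eigenvalue_adj_matrix_order:
  assumes "distinct vs" "distinct ws" "set vs = set ws"
  shows "eigenvalue (adj_matrix vs E) k \<longleftrightarrow> eigenvalue (adj_matrix ws E) k"
  using assms by (simp add: eigenvalue_adj_matrix_iff)

end

theory Submission
  imports Defs "HOL-Analysis.Function_Topology" "HOL-Analysis.L2_Norm"
begin

text \<open>Fix geometrically decreasing degree thresholds \<open>\<epsilon> \<eta>\<^sup>i m\<close>. By pigeonhole, some two consecutive
  thresholds have few edges incident to vertices with degree in between. Let \<open>H\<close> be the
  vertices above the gap, of which there are boundedly many, and \<open>S\<close> those below. Deleting the edges
  inside \<open>H\<close> and those touching the gap costs little of the largest eigenvalue, and leaves a
  bipartite graph \<open>B\<close> between \<open>H\<close> and \<open>S\<close> and a graph \<open>L\<close> of small maximum degree inside \<open>S\<close>.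
  If \<open>\<mu>\<close> is the largest eigenvalue of \<open>B \<union> L\<close>, with unit eigenvector \<open>h + l\<close> split along \<open>H\<close> and \<open>S\<close>,
  then \<open>l = y + z\<close> with \<open>y = B h / \<mu>\<close> and \<open>z = L l / \<mu>\<close>. As \<open>H\<close> is small, \<open>y\<close> is
  small in sup norm, and the gap between the thresholds makes \<open>L y\<close> negligible. Hence \<open>y\<close> and \<open>z\<close> are
  nearly orthogonal, \<open>h + y\<close> is almost an eigenvector of \<open>B\<close> and \<open>z\<close> of \<open>L\<close>, both for \<open>\<mu>\<close>, so
  that \<open>B\<close> or \<open>L\<close> has largest eigenvalue close to \<open>\<mu>\<close>.\<close>

section \<open>Inner products and the adjacency operator\<close>

definition ip :: "'a set \<Rightarrow> ('a \<Rightarrow> real) \<Rightarrow> ('a \<Rightarrow> real) \<Rightarrow> real" where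
  "ip V x y = (\<Sum>u\<in>V. x u * y u)"

text \<open>Acting on functions avoids ordering the vertices, and keeping \<open>V\<close> fixed
  while \<open>E\<close> varies lets the operators of different edge sets be added and
  compared.\<close>

definition adj_op :: "'a set \<Rightarrow> 'a set set \<Rightarrow> ('a \<Rightarrow> real) \<Rightarrow> 'a \<Rightarrow> real" where
  "adj_op V E x u = (\<Sum>v\<in>V. (if {u, v} \<in> E then 1 else 0) * x v)"

lemma ip_commute: "ip V x y = ip V y x"
  by (simp add: ip_def mult.commute)

lemma ip_add_left: "ip V (\<lambda>u. x u + y u) z = ip V x z + ip V y z"
  by (simp add: ip_def sum.distrib algebra_simps)

lemma ip_add_right: "ip V z (\<lambda>u. x u + y u) = ip V z x + ip V z y"
  by (simp add: ip_def sum.distrib algebra_simps)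

lemma ip_diff_left: "ip V (\<lambda>u. x u - y u) z = ip V x z - ip V y z"
  by (simp add: ip_def sum_subtractf algebra_simps)

lemma ip_diff_right: "ip V z (\<lambda>u. x u - y u) = ip V z x - ip V z y"
  by (simp add: ip_def sum_subtractf algebra_simps)

lemma ip_scale_left: "ip V (\<lambda>u. c * x u) z = c * ip V x z"
  by (simp add: ip_def sum_distrib_left mult.assoc)

lemma ip_scale_right: "ip V z (\<lambda>u. c * x u) = c * ip V z x"
  by (simp add: ip_def sum_distrib_left algebra_simps)

lemmas ip_bilinear = ip_add_left ip_add_right ip_diff_left ip_diff_right ip_scale_left ip_scale_right

lemma ip_cong: "(\<And>u. u \<in> V \<Longrightarrow> x u = x' u) \<Longrightarrow> (\<And>u. u \<in> V \<Longrightarrow> y u = y' u) \<Longrightarrow> ip V x y = ip V x' y'"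
  by (simp add: ip_def)

lemma ip_eq_0: "(\<And>u. u \<in> V \<Longrightarrow> x u = 0 \<or> y u = 0) \<Longrightarrow> ip V x y = 0"
  unfolding ip_def by (rule sum.neutral) auto

lemma ip_self_nonneg: "ip V x x \<ge> 0"
  by (simp add: ip_def sum_nonneg)

lemma ip_self_eq_0_iff: "finite V \<Longrightarrow> ip V x x = 0 \<longleftrightarrow> (\<forall>u\<in>V. x u = 0)"
  by (simp add: ip_def sum_nonneg_eq_0_iff)

lemma ip_Cauchy_Schwarz: "(ip V x y)\<^sup>2 \<le> ip V x x * ip V y y"
proof -
  have "\<bar>ip V x y\<bar> \<le> (\<Sum>u\<in>V. \<bar>x u\<bar> * \<bar>y u\<bar>)"
    unfolding ip_def abs_mult[symmetric] by (rule sum_abs)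
  also have "\<dots> \<le> L2_set x V * L2_set y V" by (rule L2_set_mult_ineq)
  finally have "\<bar>ip V x y\<bar>\<^sup>2 \<le> (L2_set x V * L2_set y V)\<^sup>2" by (rule power_mono) simp
  moreover have "(L2_set z V)\<^sup>2 = ip V z z" for z
    by (simp add: L2_set_def ip_def power2_eq_square sum_nonneg)
  ultimately show ?thesis by (simp add: power_mult_distrib)
qed

lemma abs_ip_le:
  assumes "ip V x x \<le> a\<^sup>2" "ip V y y \<le> b\<^sup>2" "a \<ge> 0" "b \<ge> 0"
  shows "\<bar>ip V x y\<bar> \<le> a * b"
proof -
  have "(ip V x y)\<^sup>2 \<le> a\<^sup>2 * b\<^sup>2"
    using ip_Cauchy_Schwarz[of V x y] mult_mono[OF assms(1,2)] ip_self_nonneg[of V y] by fastforce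
  then show ?thesis
    using assms(3,4) by (simp add: abs_le_square_iff[symmetric] power_mult_distrib[symmetric])
qed

lemma adj_op_add: "adj_op V E (\<lambda>v. x v + y v) = (\<lambda>u. adj_op V E x u + adj_op V E y u)"
  by (simp add: adj_op_def fun_eq_iff sum.distrib algebra_simps)

lemma adj_op_diff: "adj_op V E (\<lambda>v. x v - y v) = (\<lambda>u. adj_op V E x u - adj_op V E y u)"
  by (simp add: adj_op_def fun_eq_iff sum_subtractf algebra_simps)

lemma adj_op_scale: "adj_op V E (\<lambda>v. c * x v) = (\<lambda>u. c * adj_op V E x u)"
  by (simp add: adj_op_def fun_eq_iff sum_distrib_left algebra_simps)

lemmas adj_op_linear = adj_op_add adj_op_diff adj_op_scale

lemma adj_op_cong: "(\<And>u. u \<in> V \<Longrightarrow> x u = y u) \<Longrightarrow> adj_op V E x = adj_op V E y"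
  by (simp add: adj_op_def fun_eq_iff)

lemma adj_op_union:
  assumes "E1 \<inter> E2 = {}"
  shows "adj_op V (E1 \<union> E2) x u = adj_op V E1 x u + adj_op V E2 x u"
  unfolding adj_op_def sum.distrib[symmetric] using assms by (intro sum.cong) auto

lemma adj_op_eq_0:
  assumes "\<And>v. v \<in> V \<Longrightarrow> {u, v} \<in> E \<Longrightarrow> x v = 0"
  shows "adj_op V E x u = 0"
  unfolding adj_op_def using assms by (intro sum.neutral) auto

lemma adj_op_self_adjoint: "ip V (adj_op V E x) y = ip V x (adj_op V E y)"
proof -
  have "ip V (adj_op V E x) y = (\<Sum>u\<in>V. \<Sum>v\<in>V. (if {u, v} \<in> E then 1 else 0) * x v * y u)"
    by (simp add: ip_def adj_op_def sum_distrib_right)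
  also have "\<dots> = (\<Sum>v\<in>V. \<Sum>u\<in>V. (if {u, v} \<in> E then 1 else 0) * x v * y u)"
    by (rule sum.swap)
  also have "\<dots> = ip V x (adj_op V E y)"
    by (simp add: ip_def adj_op_def sum_distrib_left insert_commute algebra_simps)
  finally show ?thesis .
qed

section \<open>Variational characterisation of the largest eigenvalue\<close>

text \<open>A continuous form attains its maximum on the compact unit sphere; homogeneity carries
  the bound to all \<open>w\<close>.\<close>

lemma rayleigh_maximiser:
  assumes "finite V" "V \<noteq> {}"
  obtains x where "ip V x x = 1"
    "\<And>w. ip V w (adj_op V E w) \<le> ip V x (adj_op V E x) * ip V w w"
proof -
  \<comment> \<open>Functions live on the whole type, so values off \<open>V\<close> are pinned to
    0. This makes \<open>B\<close> a product of compact sets, hence compact by Tychonoff, and it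
    contains the unit vectors supported on \<open>V\<close>.\<close>
  define B where "B = PiE UNIV (\<lambda>v. if v \<in> V then {-1..1::real} else {0})"
  define S where "S = B \<inter> {x. ip V x x = 1}"
  have "compactin (product_topology (\<lambda>_. euclidean) UNIV) B"
    unfolding B_def by (subst compactin_PiE) auto
  then have "compact B"
    by (simp add: euclidean_product_topology)
  moreover have "closed {x. ip V x x = 1}"
    unfolding ip_def
    by (intro closed_Collect_eq continuous_intros continuous_on_product_coordinates)
  ultimately have "compact S"
    unfolding S_def by (rule compact_Int_closed)
  moreover have "S \<noteq> {}"
  proof -
    obtain v where v: "v \<in> V" using assms by blast
    have "(\<lambda>u. if u = v then 1 else 0) \<in> S"
      using v assms(1) by (auto simp: S_def B_def ip_def if_distrib cong: if_cong)
    then show ?thesis by blast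
  qed
  moreover have "continuous_on S (\<lambda>x. ip V x (adj_op V E x))"
    unfolding ip_def adj_op_def
    by (intro continuous_intros continuous_on_subset[OF continuous_on_product_coordinates]) auto
  ultimately obtain x where x: "x \<in> S"
    "\<And>w. w \<in> S \<Longrightarrow> ip V w (adj_op V E w) \<le> ip V x (adj_op V E x)"
    using continuous_attains_sup[of S "\<lambda>x. ip V x (adj_op V E x)"] by auto
  have "ip V w (adj_op V E w) \<le> ip V x (adj_op V E x) * ip V w w" for w
  proof (cases "ip V w w = 0")
    case True
    then have "\<forall>u\<in>V. w u = 0" using assms(1) by (simp add: ip_self_eq_0_iff)
    then have "ip V w (adj_op V E w) = 0" by (intro ip_eq_0) auto
    then show ?thesis using True by simp
  next
    case False
    define c where "c = 1 / sqrt (ip V w w)"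
    have pos: "ip V w w > 0" using False ip_self_nonneg[of V w] by linarith
    have c2: "c * c * ip V w w = 1" using pos by (simp add: c_def)
    \<comment> \<open>Besides scaling to norm 1, \<open>w\<close> must be cut off outside
      \<open>V\<close> to lie in \<open>S\<close>; neither form sees the cut.\<close>
    define w' where "w' u = (if u \<in> V then c * w u else 0)" for u
    have "ip V w' w' = ip V (\<lambda>u. c * w u) (\<lambda>u. c * w u)"
      by (intro ip_cong) (auto simp: w'_def)
    then have 1: "ip V w' w' = 1" using c2 by (simp add: ip_bilinear mult.assoc)
    have "\<bar>w' u\<bar> \<le> 1" if "u \<in> V" for u
    proof -
      have "w' u * w' u \<le> ip V w' w'"
        unfolding ip_def using assms(1) that by (intro member_le_sum) auto
      then show ?thesis
        using 1 by (simp add: power2_eq_square[symmetric] abs_square_le_1)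
    qed
    then have "w' \<in> S"
      using 1 by (auto simp: S_def B_def w'_def PiE_def Pi_def abs_le_iff minus_le_iff)
    then have "ip V w' (adj_op V E w') \<le> ip V x (adj_op V E x)" by (rule x)
    moreover have "ip V w' (adj_op V E w') = ip V (\<lambda>u. c * w u) (adj_op V E (\<lambda>u. c * w u))"
      by (subst adj_op_cong[where y = "\<lambda>u. c * w u"], simp add: w'_def, rule ip_cong)
        (auto simp: w'_def)
    ultimately have "c * c * ip V w (adj_op V E w) \<le> ip V x (adj_op V E x)"
      by (simp add: ip_bilinear adj_op_linear mult.assoc)
    then have "c * c * ip V w (adj_op V E w) * ip V w w \<le> ip V x (adj_op V E x) * ip V w w"
      using pos by (intro mult_right_mono) auto
    moreover have "c * c * ip V w (adj_op V E w) * ip V w w = ip V w (adj_op V E w)"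
      using c2 by (metis mult.assoc mult.commute mult_1)
    ultimately show ?thesis by simp
  qed
  moreover have "ip V x x = 1" using x(1) by (simp add: S_def)
  ultimately show ?thesis using that by blast
qed

text \<open>First variation: \<open>Q\<close> below is a nonnegative quadratic form vanishing at
  \<open>x\<close>. Moving from \<open>x\<close> by \<open>t\<close> times the residual
  \<open>r\<close> gives \<open>2 * t * ip V r r + t\<^sup>2 * Q r\<close>, which stays nonnegative
  for small negative \<open>t\<close> only if \<open>r\<close> vanishes on \<open>V\<close>.\<close>

lemma rayleigh_maximiser_eigenvector:
  assumes "finite V" "\<And>w. ip V w (adj_op V E w) \<le> \<mu> * ip V w w"
    "ip V x (adj_op V E x) = \<mu> * ip V x x" "u \<in> V"
  shows "adj_op V E x u = \<mu> * x u"
proof -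
  define r where "r u = \<mu> * x u - adj_op V E x u" for u
  define Q where "Q w = \<mu> * ip V w w - ip V w (adj_op V E w)" for w
  have Q0: "Q w \<ge> 0" for w using assms(2)[of w] by (simp add: Q_def)
  have rr: "ip V r r = \<mu> * ip V x r - ip V x (adj_op V E r)"
    by (subst (1) r_def[abs_def]) (simp add: ip_bilinear adj_op_self_adjoint)
  have "Q (\<lambda>u. x u + t * r u) = 2 * t * ip V r r + t\<^sup>2 * Q r" for t
    using assms(3) ip_commute[of V r x] adj_op_self_adjoint[of V E r x]
      ip_commute[of V "adj_op V E r" x]
    unfolding rr by (simp add: Q_def ip_bilinear adj_op_linear power2_eq_square algebra_simps)
  then have t: "2 * t * ip V r r + t\<^sup>2 * Q r \<ge> 0" for t using Q0 by metis
  have "ip V r r = 0"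
  proof (rule ccontr)
    assume "ip V r r \<noteq> 0"
    then have pos: "ip V r r > 0" using ip_self_nonneg[of V r] by linarith
    \<comment> \<open>At \<open>t = - s\<close> the linear term dominates; the \<open>+ 1\<close>
      keeps the denominator positive when \<open>Q r = 0\<close>.\<close>
    define s where "s = ip V r r / (Q r + 1)"
    have Q1: "Q r + 1 > 0" using Q0[of r] by linarith
    have s: "s > 0" "s * (Q r + 1) = ip V r r" using pos Q1 by (auto simp: s_def)
    have "2 * (- s) * ip V r r + (- s)\<^sup>2 * Q r = s * (s * (Q r + 1) - 2 * ip V r r - s)"
      by (simp add: power2_eq_square algebra_simps)
    also have "\<dots> < 0" using s pos by (intro mult_pos_neg) auto
    finally show False using t[of "- s"] by linarith
  qed
  then have "r u = 0" using assms(1,4) by (simp add: ip_self_eq_0_iff)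
  then show ?thesis by (simp add: r_def)
qed

text \<open>Passes from the \<open>Max\<close> over matrix eigenvalues to quadratic forms: the
  maximum of the form is an eigenvalue, and every eigenvalue is the value of the form at some unit
  vector. From here on matrices are no longer needed.\<close>

lemma largest_eigenvalue_rayleigh:
  assumes "finite V" "V \<noteq> {}"
  shows largest_eigenvalue_eigenvector: "\<exists>x. ip V x x = 1 \<and>
      (\<forall>u\<in>V. adj_op V E x u = largest_eigenvalue V E * x u)"
    and rayleigh_le_largest_eigenvalue:
      "ip V w (adj_op V E w) \<le> largest_eigenvalue V E * ip V w w"
proof -
  obtain x where x: "ip V x x = 1"
    "\<And>w. ip V w (adj_op V E w) \<le> ip V x (adj_op V E x) * ip V w w"
    using rayleigh_maximiser[OF assms] by blast
  define \<mu> where "\<mu> = ip V x (adj_op V E x)"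
  have ray: "ip V w (adj_op V E w) \<le> \<mu> * ip V w w" for w
    unfolding \<mu>_def by (rule x(2))
  have "ip V x (adj_op V E x) = \<mu> * ip V x x" unfolding \<mu>_def x(1) by simp
  then have eig: "\<forall>u\<in>V. adj_op V E x u = \<mu> * x u"
    using rayleigh_maximiser_eigenvector[OF assms(1) ray] by blast
  define vs where "vs = (SOME vs. distinct vs \<and> set vs = V)"
  have "\<exists>vs. distinct vs \<and> set vs = V" using finite_distinct_list[OF assms(1)] by blast
  then have vs: "distinct vs" "set vs = V"
    unfolding vs_def using someI_ex[of "\<lambda>vs. distinct vs \<and> set vs = V"] by auto
  let ?A = "adj_matrix vs E"
  have iff: "eigenvalue ?A k \<longleftrightarrow>
      (\<exists>x. (\<exists>v\<in>V. x v \<noteq> 0) \<and> (\<forall>u\<in>V. adj_op V E x u = k * x u))" for k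
    using eigenvalue_adj_matrix_iff[OF vs(1), of E k] by (simp add: vs(2) adj_op_def)
  have "eigenvalue ?A \<mu>"
  proof -
    have "\<exists>v\<in>V. x v \<noteq> 0" using x(1) ip_self_eq_0_iff[OF assms(1), of x] by auto
    with eig show ?thesis unfolding iff by (intro exI[of _ x] conjI)
  qed
  moreover have "k \<le> \<mu>" if k: "eigenvalue ?A k" for k
  proof -
    obtain y where y: "\<exists>v\<in>V. y v \<noteq> 0" "\<forall>u\<in>V. adj_op V E y u = k * y u"
      using k[unfolded iff] by blast
    have "ip V y (adj_op V E y) = ip V y (\<lambda>u. k * y u)" using y(2) by (intro ip_cong) auto
    then have "k * ip V y y \<le> \<mu> * ip V y y" using ray[of y] by (simp add: ip_bilinear)
    moreover have "ip V y y > 0"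
      using y(1) ip_self_eq_0_iff[OF assms(1), of y] ip_self_nonneg[of V y] by auto
    ultimately show ?thesis by simp
  qed
  \<comment> \<open>\<open>Max\<close> is meaningful only on a finite set; the eigenvalues are roots
    of the nonzero characteristic polynomial.\<close>
  moreover have "finite {k. eigenvalue ?A k}"
  proof -
    have A: "?A \<in> carrier_mat (length vs) (length vs)" by (simp add: adj_matrix_def)
    have "char_poly ?A \<noteq> 0" using degree_monic_char_poly[OF A] by auto
    then show ?thesis using poly_roots_finite by (simp add: eigenvalue_root_char_poly[OF A])
  qed
  ultimately have "largest_eigenvalue V E = \<mu>"
    unfolding largest_eigenvalue_def vs_def[symmetric] by (intro Max_eqI) auto
  then show "\<exists>x. ip V x x = 1 \<and> (\<forall>u\<in>V. adj_op V E x u = largest_eigenvalue V E * x u)"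
    "ip V w (adj_op V E w) \<le> largest_eigenvalue V E * ip V w w"
    using x(1) eig ray by auto
qed

text \<open>There are no loops, so the form vanishes at the indicator of a single vertex.\<close>

lemma largest_eigenvalue_nonneg:
  assumes "simple_graph V E"
  shows "largest_eigenvalue V E \<ge> 0"
proof -
  obtain v where v: "v \<in> V" and V: "finite V" "V \<noteq> {}"
    using assms by (auto simp: simple_graph_def)
  let ?w = "\<lambda>u. if u = v then 1 else 0 :: real"
  have "{v, v} \<notin> E" using assms by (auto simp: simple_graph_def)
  then have "ip V ?w (adj_op V E ?w) = 0" 
    by (intro ip_eq_0) (auto simp: adj_op_def intro!: sum.neutral)
  moreover have "ip V ?w ?w = 1" using v V by (simp add: ip_def if_distrib cong: if_cong)
  ultimately show ?thesis using rayleigh_le_largest_eigenvalue[OF V, of ?w E] by simp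
qed

section \<open>Degrees and edge counting\<close>

lemma card_neighbours:
  assumes "simple_graph V E"
  shows "card {v \<in> V. {u, v} \<in> E} = vertex_degree E u"
proof -
  have E: "e \<subseteq> V" "card e = 2" if "e \<in> E" for e using assms that by (auto simp: simple_graph_def)
  have "bij_betw (\<lambda>v. {u, v}) {v \<in> V. {u, v} \<in> E} {e \<in> E. u \<in> e}"
  proof (rule bij_betw_imageI)
    show "inj_on (\<lambda>v. {u, v}) {v \<in> V. {u, v} \<in> E}"
      by (auto simp: inj_on_def doubleton_eq_iff)
    show "(\<lambda>v. {u, v}) ` {v \<in> V. {u, v} \<in> E} = {e \<in> E. u \<in> e}"
    proof (intro equalityI subsetI)
      fix e assume "e \<in> {e \<in> E. u \<in> e}"
      moreover from this obtain a b where "e = {a, b}" using E(2)[of e] by (auto simp: card_2_iff)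
      ultimately show "e \<in> (\<lambda>v. {u, v}) ` {v \<in> V. {u, v} \<in> E}"
        using E(1)[of e] by (auto simp: insert_commute)
    qed auto
  qed
  then show ?thesis unfolding vertex_degree_def by (rule bij_betw_same_card)
qed

lemma simple_graph_finite_edges: "simple_graph V E \<Longrightarrow> finite E"
  by (rule finite_subset[of _ "Pow V"]) (auto simp: simple_graph_def)

lemma sum_vertex_degree:
  assumes "simple_graph V E"
  shows "(\<Sum>v\<in>V. vertex_degree E v) = 2 * card E"
proof -
  have fin: "finite V" "finite E"
    using assms simple_graph_finite_edges by (auto simp: simple_graph_def)
  have "(\<Sum>v\<in>V. vertex_degree E v) = (\<Sum>v\<in>V. \<Sum>e\<in>E. if v \<in> e then 1 else 0)"
    using fin by (simp add: vertex_degree_def sum.If_cases Int_def)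
  also have "\<dots> = (\<Sum>e\<in>E. \<Sum>v\<in>V. if v \<in> e then 1 else 0)" by (rule sum.swap)
  also have "\<dots> = (\<Sum>e\<in>E. 2)"
  proof (rule sum.cong)
    fix e assume "e \<in> E"
    then have "e \<subseteq> V" "card e = 2" using assms by (auto simp: simple_graph_def)
    then show "(\<Sum>v\<in>V. if v \<in> e then 1 else 0) = (2::nat)"
      using fin by (simp add: sum.If_cases Int_absorb1 Int_def[symmetric])
  qed simp
  finally show ?thesis by simp
qed

lemma simple_graph_subset: "simple_graph V E \<Longrightarrow> F \<subseteq> E \<Longrightarrow> simple_graph V F"
  by (auto simp: simple_graph_def)

lemma vertex_degree_mono: "finite E \<Longrightarrow> F \<subseteq> E \<Longrightarrow> vertex_degree F v \<le> vertex_degree E v"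
  unfolding vertex_degree_def by (rule card_mono) auto

section \<open>The cost of deleting edges\<close>

text \<open>Cauchy-Schwarz over ordered pairs, between the adjacency indicator and the products
  \<open>x u * x v\<close>. The latter have norm exactly \<open>ip V x x\<close>, so the constant is
  the Frobenius norm of the matrix.\<close>

lemma adj_op_form_le_sqrt:
  assumes "finite V"
  shows "ip V x (adj_op V E x) \<le> sqrt (card {(u, v) \<in> V \<times> V. {u, v} \<in> E}) * ip V x x"
proof -
  let ?a = "\<lambda>p. if {fst p, snd p} \<in> E then 1 else 0 :: real"
  let ?x = "\<lambda>p. x (fst p) * x (snd p)"
  have "ip V x (adj_op V E x) = ip (V \<times> V) ?a ?x"
    by (simp add: ip_def adj_op_def sum_distrib_left sum.cartesian_product' algebra_simps)
  also have "\<dots> \<le> \<bar>ip (V \<times> V) ?a ?x\<bar>" by simp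
  also have "\<dots> \<le> sqrt (card {(u, v) \<in> V \<times> V. {u, v} \<in> E}) * ip V x x"
  proof (rule abs_ip_le)
    have "ip (V \<times> V) ?a ?a = (\<Sum>p\<in>V \<times> V. ?a p)" by (auto simp: ip_def intro!: sum.cong)
    also have "\<dots> = card {p \<in> V \<times> V. {fst p, snd p} \<in> E}"
      using assms by (simp add: sum.If_cases Int_def)
    also have "{p \<in> V \<times> V. {fst p, snd p} \<in> E} = {(u, v) \<in> V \<times> V. {u, v} \<in> E}" by auto
    finally show "ip (V \<times> V) ?a ?a \<le> (sqrt (card {(u, v) \<in> V \<times> V. {u, v} \<in> E}))\<^sup>2"
      by simp
    have "ip (V \<times> V) ?x ?x = (ip V x x)\<^sup>2"
      by (simp add: ip_def power2_eq_square sum_product sum.cartesian_product' algebra_simps)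
    then show "ip (V \<times> V) ?x ?x \<le> (ip V x x)\<^sup>2" by simp
  qed (auto simp: ip_self_nonneg)
  finally show ?thesis .
qed

text \<open>Evaluate the forms of \<open>F\<close> and \<open>E - F\<close> at a unit top
  eigenvector of \<open>E\<close>.\<close>

lemma largest_eigenvalue_delete_edges:
  assumes "simple_graph V E" "F \<subseteq> E"
  shows "largest_eigenvalue V E \<le>
    largest_eigenvalue V F + sqrt (card {(u, v) \<in> V \<times> V. {u, v} \<in> E - F})"
proof -
  have V: "finite V" "V \<noteq> {}" using assms by (auto simp: simple_graph_def)
  obtain x where x: "ip V x x = 1" "\<forall>u\<in>V. adj_op V E x u = largest_eigenvalue V E * x u"
    using largest_eigenvalue_eigenvector[OF V] by blast
  have "F \<union> (E - F) = E" using assms by auto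
  then have "adj_op V E x = (\<lambda>u. adj_op V F x u + adj_op V (E - F) x u)"
    using adj_op_union[of F "E - F" V x] by auto
  then have "ip V x (adj_op V E x) = ip V x (adj_op V F x) + ip V x (adj_op V (E - F) x)"
    by (simp add: ip_bilinear)
  moreover have "ip V x (adj_op V E x) = ip V x (\<lambda>u. largest_eigenvalue V E * x u)"
    using x(2) by (intro ip_cong) auto
  ultimately show ?thesis
    using rayleigh_le_largest_eigenvalue[OF V, of x F] adj_op_form_le_sqrt[OF V(1), of x "E - F"] x(1)
    by (simp add: ip_bilinear)
qed


section \<open>Splitting the top eigenvector\<close>

text \<open>Test the form of \<open>B\<close> on \<open>h + Y\<close> and that of \<open>L\<close>
  on \<open>z = l - Y\<close>. Adding the two inequalities bounds
  \<open>(\<mu> - \<Lambda>) * (2 * ip V Y Y + ip V z z)\<close> by error terms, all controlled by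
  the norm of \<open>adj_op V L Y\<close>. The errors sum to at most 6 times
  \<open>\<theta>\<close>.\<close>

lemma eigenvalue_split_le:
  fixes \<mu> \<Lambda> \<theta> :: real
  assumes mu: "\<mu> > 0"
    and h: "\<And>u. u \<in> V \<Longrightarrow> \<mu> * h u = adj_op V B l u"
    and l: "\<And>u. u \<in> V \<Longrightarrow> \<mu> * l u = adj_op V B h u + adj_op V L l u"
    and norm: "ip V h h + ip V l l = 1"
    and Y_def: "Y = (\<lambda>u. (1 / \<mu>) * adj_op V B h u)"
    and orth: "ip V h (adj_op V B h) = 0" "ip V Y (adj_op V B Y) = 0"
    and ray: "\<And>w. ip V w (adj_op V B w) \<le> \<Lambda> * ip V w w"
      "\<And>w. ip V w (adj_op V L w) \<le> \<Lambda> * ip V w w"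
    and Lam: "\<Lambda> \<ge> 0"
    and theta: "ip V (adj_op V L Y) (adj_op V L Y) \<le> \<theta>\<^sup>2" "0 \<le> \<theta>" "\<theta> \<le> \<mu>"
  shows "\<mu> \<le> \<Lambda> + 7 * \<theta>"
proof (cases "\<Lambda> \<le> \<mu>")
  case True
  define z where "z = (\<lambda>u. (1 / \<mu>) * adj_op V L l u)"
  define r where "r = adj_op V L Y"
  define c where "c = ip V r l"
  define d where "d = ip V r Y"
  have Bh: "adj_op V B h = (\<lambda>u. \<mu> * Y u)" using mu by (simp add: Y_def)
  have Ll: "adj_op V L l = (\<lambda>u. \<mu> * z u)" using mu by (simp add: z_def)
  have lyz: "l u = Y u + z u" if "u \<in> V" for u
  proof -
    have "\<mu> * l u = \<mu> * (Y u + z u)" using l[OF that] unfolding Bh Ll by (simp add: distrib_left)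
    then show ?thesis using mu by simp
  qed
  have ip_l: "ip V w l = ip V w Y + ip V w z" for w
    unfolding ip_add_right[symmetric] using lyz by (intro ip_cong) auto
  \<comment> \<open>Near-orthogonality of \<open>Y\<close> and \<open>z\<close>: self-adjointness
    moves \<open>L\<close> from \<open>l\<close> onto \<open>Y\<close>, where it is small.\<close>
  have "\<mu> * ip V Y z = ip V Y (adj_op V L l)" by (simp add: Ll ip_bilinear)
  also have "\<dots> = c" by (simp add: c_def r_def adj_op_self_adjoint)
  finally have yz: "\<mu> * ip V Y z = c" .
  have "\<mu> * ip V h h = ip V h (adj_op V B l)"
    unfolding ip_scale_right[symmetric] using h by (intro ip_cong) auto
  also have "\<dots> = \<mu> * ip V Y l"
    by (simp add: adj_op_self_adjoint[symmetric] Bh ip_bilinear)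
  finally have hh: "ip V h h = ip V Y Y + ip V Y z" using mu by (simp add: ip_l)
  have ll: "ip V l l = ip V Y Y + 2 * ip V Y z + ip V z z"
    using ip_l[of l] ip_l[of Y] ip_l[of z] ip_commute[of V l Y] ip_commute[of V l z]
      ip_commute[of V z Y] by simp
  have hY: "ip V h Y = 0" using orth(1) mu by (simp add: Bh ip_bilinear)
  have "ip V h (adj_op V B Y) = \<mu> * ip V Y Y"
    by (simp add: adj_op_self_adjoint[symmetric] Bh ip_bilinear)
  moreover have "ip V Y (adj_op V B h) = \<mu> * ip V Y Y" by (simp add: Bh ip_bilinear)
  \<comment> \<open>For the test vector \<open>h + Y\<close> the diagonal terms vanish by
    \<open>orth\<close>, and each cross term equals \<open>\<mu> * ip V Y Y\<close>.\<close>
  ultimately have "2 * \<mu> * ip V Y Y \<le> \<Lambda> * (ip V h h + ip V Y Y)"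
    using ray(1)[of "\<lambda>u. h u + Y u"] orth hY ip_commute[of V Y h]
    by (simp add: ip_bilinear adj_op_linear)
  then have 1: "(\<mu> - \<Lambda>) * (2 * ip V Y Y) \<le> \<Lambda> * ip V Y z"
    by (simp add: hh algebra_simps)
  have "adj_op V L l = adj_op V L (\<lambda>u. Y u + z u)" by (intro adj_op_cong lyz)
  then have "adj_op V L z = (\<lambda>u. \<mu> * z u - r u)"
    by (auto simp: Ll adj_op_linear r_def fun_eq_iff algebra_simps)
  then have 2: "(\<mu> - \<Lambda>) * ip V z z \<le> ip V r z"
    using ray(2)[of z] ip_commute[of V r z] by (simp add: ip_bilinear algebra_simps)
  have rz: "ip V r z = c - d" using ip_l[of r] by (simp add: c_def d_def)
  have one: "2 * ip V Y Y + ip V z z = 1 - 3 * ip V Y z" using norm hh ll by linarith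
  have "\<bar>ip V r l\<bar> \<le> \<theta> * 1"
    using theta ip_self_nonneg[of V h] norm by (intro abs_ip_le) (auto simp: r_def)
  then have c: "\<bar>c\<bar> \<le> \<theta>" by (simp add: c_def)
  \<comment> \<open>This is where \<open>\<theta> \<le> \<mu>\<close> enters. It gives a crude bound
    on the norm of \<open>Y\<close>, needed only to estimate \<open>d\<close>.\<close>
  then have "\<mu> * \<bar>ip V Y z\<bar> \<le> \<mu> * 1" using yz theta mu by (metis abs_mult abs_of_pos mult_1_right order_trans)
  then have "\<bar>ip V Y z\<bar> \<le> 1" using mu by simp
  then have "ip V Y Y \<le> 2\<^sup>2" using hh ip_self_nonneg[of V l] norm by auto
  then have "\<bar>ip V r Y\<bar> \<le> \<theta> * 2"
    using theta by (intro abs_ip_le) (auto simp: r_def)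
  then have d: "\<bar>d\<bar> \<le> 2 * \<theta>" by (simp add: d_def)
  have "(\<mu> - \<Lambda>) * (1 - 3 * ip V Y z) \<le> \<Lambda> * ip V Y z + (c - d)"
    using 1 2 unfolding rz one[symmetric] by (simp add: distrib_left)
  then have "\<mu> - \<Lambda> \<le> (\<mu> - \<Lambda>) * (3 * ip V Y z) + \<Lambda> * ip V Y z + (c - d)"
    by (simp add: algebra_simps)
  moreover have "(\<mu> - \<Lambda>) * (3 * ip V Y z) + \<Lambda> * ip V Y z \<le> 3 * \<theta>"
  proof -
    \<comment> \<open>The collected coefficient is nonnegative because
      \<open>\<Lambda> \<le> \<mu>\<close>, and at most \<open>3 * \<mu>\<close>; then
      \<open>\<mu> * ip V Y z = c\<close> finishes.\<close>
    have "(\<mu> - \<Lambda>) * (3 * ip V Y z) + \<Lambda> * ip V Y z = (3 * \<mu> - 2 * \<Lambda>) * ip V Y z"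
      by (simp add: algebra_simps)
    also have "\<dots> \<le> (3 * \<mu> - 2 * \<Lambda>) * \<bar>ip V Y z\<bar>" using True mu by (intro mult_left_mono) auto
    also have "\<dots> \<le> 3 * \<mu> * \<bar>ip V Y z\<bar>" using Lam by (intro mult_right_mono) auto
    also have "\<dots> = 3 * \<bar>c\<bar>" unfolding yz[symmetric] using mu by (simp add: abs_mult)
    finally show ?thesis using c by simp
  qed
  ultimately show ?thesis using c d theta(2) by linarith
qed (use theta in auto)

text \<open>Apply the splitting inequality to the restrictions \<open>h\<close>, \<open>l\<close> of
  the top eigenvector to \<open>H\<close> and \<open>S\<close>. The work is the bound on
  \<open>adj_op V L Y\<close>: \<open>Y\<close> is at most \<open>sqrt (card H) / \<mu>\<close> in
  sup norm, and degrees in \<open>S\<close> are at most \<open>D\<close>.\<close>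

lemma high_low_degree_split:
  assumes G: "simple_graph V E" and H: "H \<subseteq> V" and S: "S \<subseteq> V" and HS: "H \<inter> S = {}"
    and deg: "\<And>u. u \<in> S \<Longrightarrow> real (vertex_degree E u) \<le> D" and D: "D \<ge> 0"
    and B_def: "B = {e \<in> E. e \<inter> H \<noteq> {} \<and> e \<inter> S \<noteq> {}}" and L_def: "L = {e \<in> E. e \<subseteq> S}"
    and mu_def: "\<mu> = largest_eigenvalue V (B \<union> L)" and mu: "\<mu> > 0"
    and theta: "real (card H) * D * (2 * real (card E)) / \<mu>\<^sup>2 \<le> \<theta>\<^sup>2" "0 \<le> \<theta>" "\<theta> \<le> \<mu>"
  shows "\<mu> \<le> max (largest_eigenvalue V B) (largest_eigenvalue V L) + 7 * \<theta>"
proof -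
  have V: "finite V" "V \<noteq> {}" using G by (auto simp: simple_graph_def)
  have sub: "B \<subseteq> E" "L \<subseteq> E" and disj: "B \<inter> L = {}" using HS by (auto simp: B_def L_def)
  obtain x where x: "ip V x x = 1" "\<forall>u\<in>V. adj_op V (B \<union> L) x u = \<mu> * x u"
    using largest_eigenvalue_eigenvector[OF V] unfolding mu_def by blast
  define h where "h u = (if u \<in> H then x u else 0)" for u
  define l where "l u = (if u \<in> S then x u else 0)" for u
  have BH: "adj_op V B w u = 0" if "\<And>v. v \<in> S \<Longrightarrow> w v = 0" "u \<notin> S" for w u
    using that by (intro adj_op_eq_0) (auto simp: B_def)
  have BS: "adj_op V B w u = 0" if "\<And>v. v \<in> H \<Longrightarrow> w v = 0" "u \<notin> H" for w u
    using that by (intro adj_op_eq_0) (auto simp: B_def)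
  have L0: "adj_op V L w u = 0" if "(\<forall>v\<in>S. w v = 0) \<or> u \<notin> S" for w u
    using that by (intro adj_op_eq_0) (auto simp: L_def)
  have x_eq: "adj_op V B x u + adj_op V L x u = \<mu> * x u" if "u \<in> V" for u
    using x(2) that adj_op_union[OF disj] by metis
  \<comment> \<open>A vertex outside \<open>H\<close> and \<open>S\<close> is isolated in
    \<open>B \<union> L\<close>, so an eigenvector for \<open>\<mu> > 0\<close> vanishes
    there.\<close>
  have x0: "x u = 0" if "u \<in> V" "u \<notin> H" "u \<notin> S" for u
  proof -
    have "{u, v} \<notin> B" for v
    proof
      assume "{u, v} \<in> B"
      then show False using that HS by (auto simp: B_def)
    qed
    then have "adj_op V B x u = 0" by (intro adj_op_eq_0) auto
    then show ?thesis using x_eq[OF that(1)] L0[of x u] that mu by simp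
  qed
  have xhl: "x u = h u + l u" if "u \<in> V" for u
    using HS x0[OF that] by (auto simp: h_def l_def)
  have split: "adj_op V F x u = adj_op V F h u + adj_op V F l u" for F u
    using adj_op_cong[of V x "\<lambda>u. h u + l u" F] xhl by (simp add: adj_op_add)
  have hS: "h u = 0" if "u \<in> S" for u using that HS by (auto simp: h_def)
  have lH: "l u = 0" if "u \<in> H" for u using that HS by (auto simp: l_def)
  have mu_h: "\<mu> * h u = adj_op V B l u" if "u \<in> V" for u
  proof (cases "u \<in> H")
    case True
    then have "u \<notin> S" using HS by auto
    then show ?thesis
      using x_eq[OF that] BH[of h u] hS L0[of h u] L0[of l u] True by (simp add: split h_def)
  next
    case False
    then show ?thesis using BS[of l u] lH by (simp add: h_def)
  qed
  have mu_l: "\<mu> * l u = adj_op V B h u + adj_op V L l u" if "u \<in> V" for u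
  proof (cases "u \<in> S")
    case True
    then have "u \<notin> H" using HS by auto
    then show ?thesis
      using x_eq[OF that] BS[of l u] lH L0[of h u] hS True by (simp add: split l_def)
  next
    case False
    then show ?thesis using BH[of h u] hS L0[of l u] by (simp add: l_def)
  qed
  have "ip V h l = 0" using HS by (intro ip_eq_0) (auto simp: h_def l_def)
  moreover have "ip V x x = ip V (\<lambda>u. h u + l u) (\<lambda>u. h u + l u)" by (intro ip_cong xhl)
  ultimately have norm: "ip V h h + ip V l l = 1"
    using x(1) ip_commute[of V l h] by (simp add: ip_bilinear)
  define Y where "Y = (\<lambda>u. (1 / \<mu>) * adj_op V B h u)"
  have YS: "Y u = 0" if "u \<notin> S" for u using BH[of h u] hS that by (simp add: Y_def)
  have orth: "ip V h (adj_op V B h) = 0" "ip V Y (adj_op V B Y) = 0"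
  proof -
    show "ip V h (adj_op V B h) = 0"
      using HS BH[of h] hS by (intro ip_eq_0) (auto simp: h_def)
    have "adj_op V B Y u = 0" if "u \<in> S" for u
      using that YS HS by (intro BS) auto
    then show "ip V Y (adj_op V B Y) = 0" using YS by (intro ip_eq_0) auto
  qed
  define b where "b = sqrt (card H) / \<mu>"
  have b0: "b \<ge> 0" using mu by (simp add: b_def)
  \<comment> \<open>Cauchy-Schwarz on \<open>H\<close> alone: a row of \<open>B\<close> has at most
    \<open>card H\<close> ones there, and \<open>h\<close> has norm at most 1.\<close>
  have Yb: "\<bar>Y u\<bar> \<le> b" for u
  proof -
    let ?a = "\<lambda>v. if {u, v} \<in> B then 1 else 0 :: real"
    have "adj_op V B h u = ip H ?a h"
      unfolding adj_op_def ip_def using V(1) H by (intro sum.mono_neutral_right) (auto simp: h_def)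
    moreover have "\<bar>ip H ?a h\<bar> \<le> sqrt (card H) * 1"
    proof (rule abs_ip_le)
      have "ip H ?a ?a \<le> (\<Sum>v\<in>H. 1)" unfolding ip_def by (intro sum_mono) auto
      then show "ip H ?a ?a \<le> (sqrt (card H))\<^sup>2" by simp
      have "ip H h h \<le> ip V h h" unfolding ip_def using V(1) H by (intro sum_mono2) auto
      then show "ip H h h \<le> 1\<^sup>2" using norm ip_self_nonneg[of V l] by simp
    qed auto
    ultimately show ?thesis using mu by (simp add: Y_def b_def abs_mult divide_right_mono)
  qed
  \<comment> \<open>Only one of the two degree factors is replaced by \<open>D\<close>; the other is
    kept so that summing over \<open>V\<close> gives \<open>2 * card E\<close>.\<close>
  have r2: "(adj_op V L Y u)\<^sup>2 \<le> D * b\<^sup>2 * vertex_degree E u" for u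
  proof (cases "u \<in> S")
    case True
    have "\<bar>adj_op V L Y u\<bar> \<le> (\<Sum>v\<in>V. \<bar>(if {u, v} \<in> L then 1 else 0) * Y v\<bar>)"
      unfolding adj_op_def by (rule sum_abs)
    also have "\<dots> \<le> (\<Sum>v\<in>V. (if {u, v} \<in> L then 1 else 0) * b)"
      using Yb by (intro sum_mono) auto
    also have "\<dots> = real (card {v \<in> V. {u, v} \<in> L}) * b"
      using V(1) by (simp add: sum_distrib_right[symmetric] sum.If_cases Int_def)
    also have "\<dots> \<le> real (vertex_degree E u) * b"
      unfolding card_neighbours[OF simple_graph_subset[OF G sub(2)]]
      using vertex_degree_mono[OF simple_graph_finite_edges[OF G] sub(2)] b0
      by (intro mult_right_mono) auto
    finally have "\<bar>adj_op V L Y u\<bar>\<^sup>2 \<le> (real (vertex_degree E u) * b)\<^sup>2"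
      by (rule power_mono) simp
    also have "\<dots> = vertex_degree E u * (b\<^sup>2 * vertex_degree E u)"
      by (simp add: power2_eq_square)
    also have "\<dots> \<le> D * (b\<^sup>2 * vertex_degree E u)"
      using deg[OF True] by (intro mult_right_mono) auto
    finally show ?thesis by (simp add: mult.assoc)
  next
    case False
    then show ?thesis using L0[of Y u] D by simp
  qed
  have "ip V (adj_op V L Y) (adj_op V L Y) \<le> (\<Sum>u\<in>V. D * b\<^sup>2 * vertex_degree E u)"
    unfolding ip_def power2_eq_square[symmetric] by (intro sum_mono r2)
  also have "\<dots> = D * b\<^sup>2 * real (\<Sum>u\<in>V. vertex_degree E u)"
    by (simp add: sum_distrib_left)
  also have "\<dots> = real (card H) * D * (2 * real (card E)) / \<mu>\<^sup>2"
    unfolding sum_vertex_degree[OF G] by (simp add: b_def power_divide)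
  also note theta(1)
  finally have r: "ip V (adj_op V L Y) (adj_op V L Y) \<le> \<theta>\<^sup>2" .
  let ?\<Lambda> = "max (largest_eigenvalue V B) (largest_eigenvalue V L)"
  have ray: "ip V w (adj_op V F w) \<le> ?\<Lambda> * ip V w w" if "F = B \<or> F = L" for w F
  proof -
    have "largest_eigenvalue V F * ip V w w \<le> ?\<Lambda> * ip V w w"
      using that ip_self_nonneg[of V w] by (intro mult_right_mono) auto
    then show ?thesis using rayleigh_le_largest_eigenvalue[OF V, of w F] by linarith
  qed
  have "?\<Lambda> \<ge> 0"
    using largest_eigenvalue_nonneg[OF simple_graph_subset[OF G sub(1)]] by simp
  then show ?thesis
    using eigenvalue_split_le[OF mu mu_h mu_l norm Y_def orth, of ?\<Lambda> \<theta>] r ray theta(2,3)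
    by blast
qed

section \<open>Counting deleted edges, and the pigeonhole\<close>

text \<open>A deleted edge that avoids \<open>M\<close> has both ends in \<open>H\<close>. An edge
  meeting \<open>M\<close> is counted from its end in \<open>M\<close>, in both orientations, whence
  the factor 2.\<close>

lemma card_deleted_pairs:
  assumes G: "simple_graph V E" and V: "V = H \<union> M \<union> S"
  shows "card {(u, v) \<in> V \<times> V. {u, v} \<in> E - ({e \<in> E. e \<inter> H \<noteq> {} \<and> e \<inter> S \<noteq> {}} \<union> {e \<in> E. e \<subseteq> S})}
    \<le> (card H)\<^sup>2 + 2 * (\<Sum>u\<in>M. vertex_degree E u)" (is "card ?P \<le> _")
proof -
  have fin: "finite H" "finite M" "finite V" using G V by (auto simp: simple_graph_def)
  let ?N = "Sigma M (\<lambda>u. {v \<in> V. {u, v} \<in> E})"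
  have N: "card ?N = (\<Sum>u\<in>M. vertex_degree E u)"
    using fin by (simp add: card_neighbours[OF G])
  have finN: "finite ?N" using fin by auto
  have "?P \<subseteq> H \<times> H \<union> (?N \<union> prod.swap ` ?N)"
  proof
    fix p assume p: "p \<in> ?P"
    obtain u v where uv: "p = (u, v)" by (cases p)
    then have *: "u \<in> V" "v \<in> V" "{u, v} \<in> E" "\<not> {u, v} \<subseteq> S"
      "{u, v} \<inter> H = {} \<or> {u, v} \<inter> S = {}" using p by auto
    show "p \<in> H \<times> H \<union> (?N \<union> prod.swap ` ?N)"
    proof (cases "u \<in> M \<or> v \<in> M")
      case True
      moreover have "p \<in> ?N" if "u \<in> M" using * uv that by auto
      moreover have "(v, u) \<in> ?N" if "v \<in> M" using * that by (auto simp: insert_commute)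
      ultimately show ?thesis unfolding uv by (auto simp: image_iff)
    next
      case False
      then show ?thesis using * V uv by auto
    qed
  qed
  then have "card ?P \<le> card (H \<times> H \<union> (?N \<union> prod.swap ` ?N))"
    using fin finN by (intro card_mono) auto
  also have "\<dots> \<le> card (H \<times> H) + (card ?N + card (prod.swap ` ?N))"
    by (meson add_left_mono card_Un_le order_trans)
  also have "\<dots> \<le> card (H \<times> H) + (card ?N + card ?N)"
    using card_image_le[OF finN] by simp
  finally show ?thesis by (simp add: N card_cartesian_product power2_eq_square)
qed

text \<open>Pigeonhole by averaging; it will select a degree band carrying few edges.\<close>

lemma disjoint_family_light_member:
  fixes d :: "'a \<Rightarrow> real"
  assumes "finite V" "\<And>v. v \<in> V \<Longrightarrow> d v \<ge> 0" "\<And>i. i < K \<Longrightarrow> M i \<subseteq> V" "K > 0"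
    "\<And>i j. i < K \<Longrightarrow> j < K \<Longrightarrow> i \<noteq> j \<Longrightarrow> M i \<inter> M j = {}"
  obtains i where "i < K" "sum d (M i) \<le> sum d V / real K"
proof -
  have "(\<Sum>i<K. sum d (M i)) = sum d (\<Union>i<K. M i)"
    using assms finite_subset[OF assms(3) assms(1)] by (intro sum.UNION_disjoint[symmetric]) auto
  also have "\<dots> \<le> sum d V" using assms by (intro sum_mono2) auto
  finally have le: "(\<Sum>i<K. sum d (M i)) \<le> sum d V" .
  have "\<exists>i<K. sum d (M i) \<le> sum d V / real K"
  proof (rule ccontr)
    assume "\<not> ?thesis"
    then have "(\<Sum>i<K. sum d V / real K) < (\<Sum>i<K. sum d (M i))"
      using assms(4) by (intro sum_strict_mono) (auto simp: not_le)
    then show False using le assms(4) by simp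
  qed
  then show ?thesis using that by blast
qed

section \<open>Choice of constants and conclusion\<close>

text \<open>Loss budget: deleting edges costs at most
  \<open>N / 4 + \<epsilon> / 4 * sqrt m\<close>, and the splitting costs
  \<open>7 * \<theta> = \<epsilon> / 4 * sqrt m\<close>. Together this stays below
  \<open>N + \<epsilon> * sqrt m\<close>.\<close>

lemma bipartite_or_low_degree_subgraph:
  fixes \<epsilon> :: real
  assumes G: "simple_graph V E" and eps: "0 < \<epsilon>" "\<epsilon> < 1"
    and eta: "\<eta> = (\<epsilon> / 112)\<^sup>2" and K: "64 / \<epsilon>\<^sup>2 \<le> real K" and N: "N = 8 / (\<epsilon> * \<eta> ^ K)"
    and lam: "largest_eigenvalue V E > sqrt (card E)" and big: "N \<le> sqrt (card E)"
  shows "\<exists>F \<subseteq> E. largest_eigenvalue V F > (1 - \<epsilon>) * sqrt (card E) - N \<and>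
    (bipartite V F \<or> (\<forall>u\<in>V. real (vertex_degree F u) \<le> \<epsilon> * card E))"
proof -
  define m where "m = real (card E)"
  define d where "d u = real (vertex_degree E u)" for u
  define \<delta> where "\<delta> i = \<epsilon> * \<eta> ^ i" for i
  have V: "finite V" "V \<noteq> {}" using G by (auto simp: simple_graph_def)
  have sum_d: "sum d V = 2 * m"
    using sum_vertex_degree[OF G] unfolding d_def m_def by (simp flip: of_nat_sum)
  have eta01: "0 < \<eta>" "\<eta> \<le> 1"
    using eps by (auto simp: eta power_le_one)
  have delta: "0 < \<delta> i" "\<delta> i \<le> \<epsilon>" for i
    using eps eta01 by (auto simp: \<delta>_def power_le_one mult_left_le)
  have delta_mono: "\<delta> j \<le> \<delta> i" if "i \<le> j" for i j
    using that eps eta01 by (auto simp: \<delta>_def intro!: mult_left_mono power_decreasing)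
  have N0: "N > 0" and N_delta: "N = 8 / \<delta> K" using eps eta01 by (auto simp: N \<delta>_def)
  have "0 < sqrt m" using N0 big unfolding m_def by linarith
  then have m0: "sqrt m > 0" "m > 0" by simp_all
  have "0 < 64 / \<epsilon>\<^sup>2" using eps by simp
  then have K0: "K > 0" using K by (cases K) auto
  \<comment> \<open>Half-open bands between consecutive thresholds, so that distinct ones are
    disjoint.\<close>
  define M where "M i = {u \<in> V. \<delta> (Suc i) * m < d u \<and> d u \<le> \<delta> i * m}" for i
  have M_disj: "M i \<inter> M j = {}" if "i < j" for i j
  proof -
    have "\<delta> j * m \<le> \<delta> (Suc i) * m"
      using delta_mono[of "Suc i" j] that m0 by (intro mult_right_mono) auto
    then show ?thesis by (auto simp: M_def)
  qed
  have "M i \<inter> M j = {}" if "i \<noteq> j" for i j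
    using that M_disj[of i j] M_disj[of j i] by (cases i j rule: linorder_cases) auto
  moreover have "M i \<subseteq> V" "d u \<ge> 0" for i u by (auto simp: d_def M_def)
  ultimately obtain i where i: "i < K" "sum d (M i) \<le> sum d V / K"
    using disjoint_family_light_member[of V d K M] V(1) K0 by metis
  define H where "H = {u \<in> V. \<delta> i * m < d u}"
  define S where "S = {u \<in> V. d u \<le> \<delta> (Suc i) * m}"
  have "\<delta> (Suc i) * m \<le> \<delta> i * m" using delta_mono[of i "Suc i"] m0 by simp
  then have parts: "V = H \<union> M i \<union> S" "H \<inter> S = {}" "H \<subseteq> V" "S \<subseteq> V"
    by (auto simp: H_def S_def M_def)
  \<comment> \<open>Vertices of \<open>H\<close> have degree above \<open>\<delta> i * m\<close>
    while all degrees sum to \<open>2 * m\<close>.\<close>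
  have "real (card H) * (\<delta> i * m) = (\<Sum>u\<in>H. \<delta> i * m)" by simp
  also have "\<dots> \<le> sum d H" by (intro sum_mono) (auto simp: H_def)
  also have "\<dots> \<le> sum d V" using V parts(3) by (intro sum_mono2) (auto simp: d_def)
  finally have "(real (card H) * \<delta> i) * m \<le> 2 * m" using sum_d by simp
  then have cardH: "real (card H) * \<delta> i \<le> 2" using m0 by simp
  have "real (card H) \<le> 2 / \<delta> i" using cardH delta[of i] by (simp add: field_simps)
  \<comment> \<open>Removes the dependence on \<open>i\<close>, which varies with the graph;
    \<open>N\<close> may depend only on \<open>\<epsilon>\<close>.\<close>
  also have "\<dots> \<le> 2 / \<delta> K" using delta[of K] delta_mono[of i K] i by (intro divide_left_mono) auto
  finally have H_N: "real (card H) \<le> N / 4" by (simp add: N_delta)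
  define B where "B = {e \<in> E. e \<inter> H \<noteq> {} \<and> e \<inter> S \<noteq> {}}"
  define L where "L = {e \<in> E. e \<subseteq> S}"
  define \<mu> where "\<mu> = largest_eigenvalue V (B \<union> L)"
  let ?P = "{(u, v) \<in> V \<times> V. {u, v} \<in> E - (B \<union> L)}"
  have "real (card ?P) \<le> real ((card H)\<^sup>2 + 2 * (\<Sum>u\<in>M i. vertex_degree E u))"
    using card_deleted_pairs[OF G parts(1)] unfolding B_def L_def of_nat_le_iff .
  also have "\<dots> = (real (card H))\<^sup>2 + 2 * sum d (M i)" by (simp add: d_def)
  also have "\<dots> \<le> (real (card H))\<^sup>2 + 4 * m / K" using i(2) sum_d by simp
  \<comment> \<open>The condition on \<open>K\<close> is exactly what this inequality
    requires.\<close>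
  also have "4 * m / K \<le> (\<epsilon> / 4 * sqrt m)\<^sup>2"
  proof -
    have "64 \<le> real K * \<epsilon>\<^sup>2" using K eps by (simp add: field_simps)
    then have "64 * m \<le> real K * \<epsilon>\<^sup>2 * m" using m0 by (intro mult_right_mono) auto
    then show ?thesis using m0 K0 by (simp add: field_simps power_mult_distrib)
  qed
  also have "(real (card H))\<^sup>2 + (\<epsilon> / 4 * sqrt m)\<^sup>2 \<le> (real (card H) + \<epsilon> / 4 * sqrt m)\<^sup>2"
    using eps m0 by (simp add: power2_sum)
  finally have "sqrt (card ?P) \<le> real (card H) + \<epsilon> / 4 * sqrt m"
    using eps m0 by (intro real_le_lsqrt) auto
  moreover have "B \<union> L \<subseteq> E" by (auto simp: B_def L_def)
  ultimately have "largest_eigenvalue V E \<le> \<mu> + (real (card H) + \<epsilon> / 4 * sqrt m)"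
    using largest_eigenvalue_delete_edges[OF G, of "B \<union> L"] unfolding \<mu>_def by linarith
  then have mu: "sqrt m - N / 4 - \<epsilon> / 4 * sqrt m < \<mu>" using lam H_N unfolding m_def by linarith
  have "\<epsilon> * sqrt m \<le> sqrt m" using eps m0 by simp
  \<comment> \<open>Each of the two subtracted terms is at most a quarter of
    \<open>sqrt m\<close>.\<close>
  then have mu_half: "sqrt m / 2 < \<mu>" using mu big unfolding m_def by linarith
  then have mu0: "\<mu> > 0" using m0 by linarith
  define \<theta> where "\<theta> = \<epsilon> / 28 * sqrt m"
  have "\<mu> \<le> max (largest_eigenvalue V B) (largest_eigenvalue V L) + 7 * \<theta>"
  proof (rule high_low_degree_split[OF G parts(3,4,2) _ _ B_def L_def \<mu>_def mu0])
    show "real (vertex_degree E u) \<le> \<delta> (Suc i) * m" if "u \<in> S" for u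
      using that by (simp add: S_def d_def)
    show "0 \<le> \<delta> (Suc i) * m" using delta[of "Suc i"] m0 by simp
    \<comment> \<open>Since \<open>\<delta> (Suc i) = \<eta> * \<delta> i\<close>, the size of
      \<open>H\<close> cancels against \<open>\<delta> i\<close> and only the gap ratio
      \<open>\<eta>\<close> remains. The 112 in \<open>\<eta>\<close> is \<open>4 * 28\<close>,
      chosen to match \<open>\<theta>\<^sup>2 * (sqrt m / 2)\<^sup>2\<close> exactly.\<close>
    have "real (card H) * (\<delta> (Suc i) * m) * (2 * real (card E)) = (real (card H) * \<delta> i) * (2 * \<eta> * m\<^sup>2)"
      by (simp add: \<delta>_def m_def power2_eq_square)
    also have "\<dots> \<le> 2 * (2 * \<eta> * m\<^sup>2)" using cardH eta01 by (intro mult_right_mono) auto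
    also have "\<dots> = \<theta>\<^sup>2 * (sqrt m / 2)\<^sup>2"
      using m0 by (simp add: \<theta>_def eta power_mult_distrib power_divide power2_eq_square)
    also have "\<dots> \<le> \<theta>\<^sup>2 * \<mu>\<^sup>2" using mu_half m0 by (intro mult_left_mono power_mono) auto
    finally show "real (card H) * (\<delta> (Suc i) * m) * (2 * real (card E)) / \<mu>\<^sup>2 \<le> \<theta>\<^sup>2"
      using mu0 by (simp add: divide_le_eq)
    show "0 \<le> \<theta>" using eps m0 by (simp add: \<theta>_def)
    show "\<theta> \<le> \<mu>" using \<open>\<epsilon> * sqrt m \<le> sqrt m\<close> mu_half m0 unfolding \<theta>_def by linarith
  qed
  then have max: "max (largest_eigenvalue V B) (largest_eigenvalue V L) > (1 - \<epsilon>) * sqrt m - N"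
  proof -
    have "7 * \<theta> = \<epsilon> * sqrt m / 4" by (simp add: \<theta>_def)
    moreover have "(1 - \<epsilon>) * sqrt m = sqrt m - \<epsilon> * sqrt m" by (simp add: left_diff_distrib)
    moreover have "\<epsilon> * sqrt m > 0" using eps m0 by simp
    ultimately show ?thesis
      using mu N0 \<open>\<mu> \<le> max _ _ + 7 * \<theta>\<close> by linarith
  qed
  have "bipartite V B"
    unfolding bipartite_def
  \<comment> \<open>The classes must cover \<open>V\<close>, so the second one is
    \<open>V - H\<close> rather than \<open>S\<close>; it also takes the vertices of
    \<open>M i\<close>, isolated in \<open>B\<close>.\<close>
  proof (rule exI[of _ H], rule exI[of _ "V - H"], intro conjI ballI)
    fix e assume e: "e \<in> B"
    then obtain a b where ab: "a \<in> e \<inter> H" "b \<in> e \<inter> S" by (auto simp: B_def)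
    moreover have "card e = 2" using e G by (auto simp: B_def simple_graph_def)
    ultimately have "e = {a, b}" using parts(2) by (auto simp: card_2_iff)
    then show "\<exists>x\<in>H. \<exists>y\<in>V - H. e = {x, y}" using ab parts by blast
  qed (use parts in auto)
  moreover have "real (vertex_degree L u) \<le> \<epsilon> * m" if "u \<in> V" for u
  proof (cases "u \<in> S")
    case True
    have "real (vertex_degree L u) \<le> d u"
      using vertex_degree_mono[OF simple_graph_finite_edges[OF G], of L] by (simp add: d_def L_def)
    also have "\<dots> \<le> \<delta> (Suc i) * m" using True by (simp add: S_def)
    also have "\<dots> \<le> \<epsilon> * m" using delta m0 by (intro mult_right_mono) auto
    finally show ?thesis .
  next
    case False
    then have "{e \<in> L. u \<in> e} = {}" by (auto simp: L_def)
    then have "vertex_degree L u = 0" unfolding vertex_degree_def by (simp only: card.empty)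
    then show ?thesis using eps m0 by simp
  qed
  moreover have "B \<subseteq> E" "L \<subseteq> E" by (auto simp: B_def L_def)
  ultimately show ?thesis
    using max unfolding m_def by (auto simp: less_max_iff_disj)
qed

theorem theorem1p8:
  shows "\<forall>\<epsilon>::real. \<epsilon> > 0 \<longrightarrow> (\<exists>N::real. \<forall>(V::'a set) (E::'a set set) (m::nat).
    simple_graph V E \<and> card E = m \<and> largest_eigenvalue V E > sqrt (real m) \<longrightarrow>
    (\<exists>V' E'. is_subgraph V' E' V E \<and>
       largest_eigenvalue V' E' > (1 - \<epsilon>) * sqrt (real m) - N \<and>
       (bipartite V' E' \<or> real (max_degree V' E') \<le> \<epsilon> * real m)))"
proof (intro allI impI)
  fix \<epsilon> :: real assume eps: "\<epsilon> > 0"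
  define K where "K = nat \<lceil>64 / \<epsilon>\<^sup>2\<rceil>"
  define \<eta> where "\<eta> = (\<epsilon> / 112)\<^sup>2"
  define N where "N = 8 / (\<epsilon> * \<eta> ^ K)"
  have N0: "N > 0" using eps by (simp add: N_def \<eta>_def)
  have K: "64 / \<epsilon>\<^sup>2 \<le> real K" unfolding K_def by (rule real_nat_ceiling_ge)
  show "\<exists>N::real. \<forall>(V::'a set) (E::'a set set) (m::nat).
    simple_graph V E \<and> card E = m \<and> largest_eigenvalue V E > sqrt (real m) \<longrightarrow>
    (\<exists>V' E'. is_subgraph V' E' V E \<and>
       largest_eigenvalue V' E' > (1 - \<epsilon>) * sqrt (real m) - N \<and>
       (bipartite V' E' \<or> real (max_degree V' E') \<le> \<epsilon> * real m))"
  proof (intro exI[of _ N] allI impI)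
    fix V :: "'a set" and E :: "'a set set" and m :: nat
    assume *: "simple_graph V E \<and> card E = m \<and> largest_eigenvalue V E > sqrt (real m)"
    then have G: "simple_graph V E" and V: "finite V" "V \<noteq> {}" by (auto simp: simple_graph_def)
    have "\<exists>F \<subseteq> E. largest_eigenvalue V F > (1 - \<epsilon>) * sqrt m - N \<and>
      (bipartite V F \<or> (\<forall>u\<in>V. real (vertex_degree F u) \<le> \<epsilon> * m))"
    proof (cases "\<epsilon> < 1 \<and> N \<le> sqrt m")
      case True
      then show ?thesis
        using bipartite_or_low_degree_subgraph[OF G eps _ \<eta>_def K N_def] * by auto
    next
      case False
      \<comment> \<open>For \<open>\<epsilon> \<ge> 1\<close> or small \<open>m\<close> the target
        is negative, so the edgeless graph on \<open>V\<close> already satisfies (a).\<close>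
      have "(1 - \<epsilon>) * sqrt m < N"
      proof (cases "\<epsilon> < 1")
        case True
        then have "(1 - \<epsilon>) * sqrt m \<le> sqrt m" using eps by (simp add: mult_left_le_one_le)
        then show ?thesis using True False by linarith
      next
        case False
        then have "(1 - \<epsilon>) * sqrt m \<le> 0" by (simp add: mult_nonpos_nonneg)
        then show ?thesis using N0 by linarith
      qed
      moreover have "largest_eigenvalue V {} \<ge> 0"
        using V by (intro largest_eigenvalue_nonneg) (simp add: simple_graph_def)
      moreover have "bipartite V {}" by (auto simp: bipartite_def)
      ultimately show ?thesis by (intro exI[of _ "{}"]) auto
    qed
    then obtain F where F: "F \<subseteq> E" "largest_eigenvalue V F > (1 - \<epsilon>) * sqrt m - N"
      "bipartite V F \<or> (\<forall>u\<in>V. real (vertex_degree F u) \<le> \<epsilon> * m)" by blast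
    have "real (max_degree V F) \<le> \<epsilon> * m" if "\<forall>u\<in>V. real (vertex_degree F u) \<le> \<epsilon> * m"
    proof -
      have "max_degree V F \<in> vertex_degree F ` V"
        unfolding max_degree_def using V by (intro Max_in) auto
      then show ?thesis using that by auto
    qed
    moreover have "is_subgraph V F V E"
      using F(1) simple_graph_subset[OF G] by (simp add: is_subgraph_def)
    ultimately show "\<exists>V' E'. is_subgraph V' E' V E \<and>
       largest_eigenvalue V' E' > (1 - \<epsilon>) * sqrt (real m) - N \<and>
       (bipartite V' E' \<or> real (max_degree V' E') \<le> \<epsilon> * real m)"
      using F by blast
  qed
qed

end
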